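(* Let $d\ge1$, $T>0$, $\sigma\in\mathbb{R}$ with $\sigma\ne0$, and let $b\in L^{\infty}(0,T;C_b^{\alpha}(\mathbb{R}^d;\mathbb{R}^d))$ for some $\alpha\in(0,1)$. Denote by $\phi_t=\phi_{0,t}$ the stochastic flow of the SDE $dX_t=b(t,X_t)\,dt+\sigma\,dW_t$. Then for any sequence $(v_n)\subset L^{\infty}(\mathbb{R}^d)$ and $v\in L^{\infty}(\mathbb{R}^d)$ such that $v_n\to v$ in the weak* topology $\sigma(L^{\infty}(\mathbb{R}^d),L^1(\mathbb{R}^d))$, one has $$v_n(\phi_t^{-1}(\cdot))\to v(\phi_t^{-1}(\cdot))\quad\text{in the weak* topology, uniformly in }t\in[0,T],\ P\text{-a.s.},$$ that is, $P$-a.s., for every $f\in L^1(\mathbb{R}^d)$, $$\lim_{n\to\infty}\ \sup_{t\in[0,T]}\left|\int_{\mathbb{R}^d}\left[v_n(\phi_t^{-1}(y))-v(\phi_t^{-1}(y))\right]f(y)\,dy\right|=0.$$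
   Context: Setting: a stochastic basis $(\Omega,(\mathcal{F}_t),\mathcal{F},P)$ with a $d$-dimensional Brownian motion $W=(W_t)$ is given. For $\alpha\in(0,1)$, $L^{\infty}(0,T;C_b^{\alpha}(\mathbb{R}^d;\mathbb{R}^d))$ is the set of bounded Borel functions $f:[0,T]\times\mathbb{R}^d\to\mathbb{R}^d$ with $\sup_{t\in[0,T]}\sup_{x\ne y}|f(t,x)-f(t,y)|/|x-y|^{\alpha}<\infty$. Stochastic flow: for $\sigma\ne0$ and $b$ as in the claim it is known that the SDE $dX_t=b(t,X_t)\,dt+\sigma\,dW_t$, $X_0=x$, has for each $x\in\mathbb{R}^d$ a unique continuous adapted solution on $[0,T]$, and that there is a stochastic flow of diffeomorphisms $\phi_t=\phi(t,\omega):\mathbb{R}^d\to\mathbb{R}^d$, i.e. $\phi_t(x)$ is the unique solution started from $x$ at time $0$ and each $\phi_t$ is a diffeomorphism of $\mathbb{R}^d$; $P$-a.s. $\phi_t,\phi_t^{-1}$ and their spatial derivatives are continuous in $(t,x)\in[0,T]\times\mathbb{R}^d$. *)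

theory Defs
  imports "HOL-Probability.Probability"
begin

section \<open>Stochastic bases and Brownian motion\<close>

text \<open>Time runs through \<open>[0, \<infinity>)\<close>; what \<open>F t\<close> and \<open>W t\<close> are for negative \<open>t\<close> is irrelevant.
  No completeness or right-continuity of the filtration is required.\<close>

locale stochastic_basis = prob_space M
  for M :: "'w measure" and F :: "real \<Rightarrow> 'w measure" +
  assumes subalgebra_F: "\<And>t. 0 \<le> t \<Longrightarrow> subalgebra M (F t)"
    and sets_F_mono: "\<And>s t. 0 \<le> s \<Longrightarrow> s \<le> t \<Longrightarrow> sets (F s) \<subseteq> sets (F t)"

text \<open>Increments over \<open>[s, t]\<close> have the law \<open>N(0, (t - s) I)\<close>, given by its density.\<close>

locale brownian_motion = stochastic_basis M F
  for M :: "'w measure" and F :: "real \<Rightarrow> 'w measure"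
    and W :: "real \<Rightarrow> 'w \<Rightarrow> real ^ 'n" +
  assumes adapted: "\<And>t. 0 \<le> t \<Longrightarrow> W t \<in> borel_measurable (F t)"
    and start_0: "AE \<omega> in M. W 0 \<omega> = 0"
    and continuous_paths: "AE \<omega> in M. continuous_on {0..} (\<lambda>t. W t \<omega>)"
    and indep_increments: "\<And>s t. 0 \<le> s \<Longrightarrow> s < t \<Longrightarrow>
      indep_set (sets (F s)) {(\<lambda>\<omega>. W t \<omega> - W s \<omega>) -` A \<inter> space M | A. A \<in> sets borel}"
    and gaussian_increments: "\<And>s t. 0 \<le> s \<Longrightarrow> s < t \<Longrightarrow>
      distributed M lborel (\<lambda>\<omega>. W t \<omega> - W s \<omega>)
        (\<lambda>x. ennreal (\<Prod>i\<in>UNIV. normal_density 0 (sqrt (t - s)) (x $ i)))"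

section \<open>The drift class \<open>L\<^sup>\<infinity>(0,T; C\<^sub>b\<^sup>\<alpha>)\<close>\<close>

text \<open>A function on \<open>[0,T] \<times> \<real>\<^sup>d\<close> is represented by a total function whose values for
  \<open>t \<notin> [0,T]\<close> are unconstrained.\<close>

definition Linf_Holder :: "real \<Rightarrow> real \<Rightarrow> (real \<Rightarrow> real ^ 'n \<Rightarrow> real ^ 'n) set" where
  "Linf_Holder T \<alpha> = {f.
     (\<lambda>(t, x). f t x) \<in> borel_measurable (restrict_space borel ({0..T} \<times> UNIV)) \<and>
     bounded ((\<lambda>(t, x). f t x) ` ({0..T} \<times> UNIV)) \<and>
     bdd_above {norm (f t x - f t y) / norm (x - y) powr \<alpha> | t x y. t \<in> {0..T} \<and> x \<noteq> y}}"

section \<open>Solutions of \<open>dX = b(t, X) dt + \<sigma> dW\<close> and stochastic flows\<close>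

definition sde_solution ::
  "'w measure \<Rightarrow> (real \<Rightarrow> 'w measure) \<Rightarrow> (real \<Rightarrow> 'w \<Rightarrow> real ^ 'n) \<Rightarrow> real \<Rightarrow>
   (real \<Rightarrow> real ^ 'n \<Rightarrow> real ^ 'n) \<Rightarrow> real \<Rightarrow> real ^ 'n \<Rightarrow> (real \<Rightarrow> 'w \<Rightarrow> real ^ 'n) \<Rightarrow> bool" where
  "sde_solution M F W T b \<sigma> x X \<longleftrightarrow>
     (\<forall>t\<in>{0..T}. X t \<in> borel_measurable (F t)) \<and>
     (AE \<omega> in M. continuous_on {0..T} (\<lambda>t. X t \<omega>)) \<and>
     (AE \<omega> in M. set_integrable lborel {0..T} (\<lambda>s. b s (X s \<omega>))) \<and>
     (AE \<omega> in M. \<forall>t\<in>{0..T}.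
        X t \<omega> = x + (LINT s:{0..t}|lborel. b s (X s \<omega>)) + \<sigma> *\<^sub>R W t \<omega>)"

text \<open>A diffeomorphism is of class \<open>C\<^sup>1\<close>, together with its inverse.\<close>

definition diffeomorphism :: "(real ^ 'n \<Rightarrow> real ^ 'n) \<Rightarrow> bool" where
  "diffeomorphism f \<longleftrightarrow> bij f \<and>
     (\<forall>x. f differentiable (at x)) \<and> continuous_on UNIV (\<lambda>x. jacobian f (at x)) \<and>
     (\<forall>x. inv f differentiable (at x)) \<and> continuous_on UNIV (\<lambda>x. jacobian (inv f) (at x))"

text \<open>\<open>\<phi> t \<omega>\<close> is the random map \<open>x \<mapsto> \<phi>\<^sub>t(x)\<close>; the initial time is 0 throughout.\<close>

definition stochastic_flow ::
  "'w measure \<Rightarrow> (real \<Rightarrow> 'w measure) \<Rightarrow> (real \<Rightarrow> 'w \<Rightarrow> real ^ 'n) \<Rightarrow> real \<Rightarrow>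
   (real \<Rightarrow> real ^ 'n \<Rightarrow> real ^ 'n) \<Rightarrow> real \<Rightarrow>
   (real \<Rightarrow> 'w \<Rightarrow> real ^ 'n \<Rightarrow> real ^ 'n) \<Rightarrow> bool" where
  "stochastic_flow M F W T b \<sigma> \<phi> \<longleftrightarrow>
     (\<forall>x. sde_solution M F W T b \<sigma> x (\<lambda>t \<omega>. \<phi> t \<omega> x)) \<and>
     (AE \<omega> in M.
        (\<forall>t\<in>{0..T}. diffeomorphism (\<phi> t \<omega>)) \<and>
        continuous_on ({0..T} \<times> UNIV) (\<lambda>(t, x). \<phi> t \<omega> x) \<and>
        continuous_on ({0..T} \<times> UNIV) (\<lambda>(t, x). inv (\<phi> t \<omega>) x) \<and>
        continuous_on ({0..T} \<times> UNIV) (\<lambda>(t, x). jacobian (\<phi> t \<omega>) (at x)) \<and>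
        continuous_on ({0..T} \<times> UNIV) (\<lambda>(t, x). jacobian (inv (\<phi> t \<omega>)) (at x)))"

section \<open>\<open>L\<^sup>\<infinity>\<close> and its weak* topology\<close>

text \<open>Elements of \<open>L\<^sup>\<infinity>(\<real>\<^sup>d)\<close> and \<open>L\<^sup>1(\<real>\<^sup>d)\<close> are represented by arbitrary
  Lebesgue measurable representatives of their classes.\<close>

definition Linf :: "(real ^ 'n \<Rightarrow> real) set" where
  "Linf = {v. v \<in> borel_measurable lebesgue \<and> (\<exists>C. AE x in lebesgue. \<bar>v x\<bar> \<le> C)}"

definition weak_star_convergent ::
  "(nat \<Rightarrow> real ^ 'n \<Rightarrow> real) \<Rightarrow> (real ^ 'n \<Rightarrow> real) \<Rightarrow> bool" where
  "weak_star_convergent vs v \<longleftrightarrow>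
     (\<forall>f. integrable lebesgue f \<longrightarrow>
        (\<lambda>n. LINT x|lebesgue. vs n x * f x) \<longlonglongrightarrow> (LINT x|lebesgue. v x * f x))"

end

theory Submission
  imports Defs
begin

text \<open>The argument is pathwise: fix \<open>\<omega>\<close> outside the null set where the flow fails to be
  regular, so that \<open>\<phi>\<^sub>t(x)\<close> and its Jacobian are jointly continuous in \<open>(t, x)\<close>.

  Put \<open>g\<^sub>n = v\<^sub>n - v\<close>. The change of variables \<open>y = \<phi>\<^sub>t(x)\<close> gives
  \<open>\<integral> g\<^sub>n(\<phi>\<^sub>t\<inverse>(y)) f(y) dy = \<integral> g\<^sub>n(x) h\<^sub>t(x) dx\<close> with \<open>h\<^sub>t = \<bar>det D\<phi>\<^sub>t\<bar> (f \<circ> \<phi>\<^sub>t)\<close>, which moves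
  the time dependence from \<open>g\<^sub>n\<close> to an integrable function. The curve \<open>t \<mapsto> h\<^sub>t\<close> is continuous
  into \<open>L\<^sup>1\<close>, so its image over \<open>[0,T]\<close> is compact, and a bounded sequence that tends to zero
  weak* does so uniformly on compact subsets of \<open>L\<^sup>1\<close>. That \<open>(g\<^sub>n)\<close> is bounded in \<open>L\<^sup>\<infinity>\<close> is the
  uniform boundedness principle, \<open>ess_bounded_if_pointwise_bounded\<close>.

  If \<open>f\<close> is the indicator of an open set of finite measure, continuity of \<open>t \<mapsto> h\<^sub>t\<close> follows
  from lower semicontinuity of the indicator together with conservation of mass,
  \<open>L1_continuous_flow_density\<close>. General \<open>f\<close> are approximated in \<open>L\<^sup>1\<close> by combinations of these
  (\<open>uniform_limit_weak_star_transport\<close>), at a cost controlled by the uniform bound on \<open>g\<^sub>n\<close>.\<close>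

section \<open>Relabelling coordinates\<close>

text \<open>Renaming the indices along a bijection conjugates the permutations in the Leibniz
  formula, and conjugation preserves signs.\<close>

lemma det_reindex:
  fixes A :: "'a::comm_ring_1 ^ 'n ^ 'n" and e :: "'m::finite \<Rightarrow> 'n"
  assumes "bij e"
  shows "det (\<chi> i j. A $ e i $ e j) = det A"
proof -
  let ?P = "\<lambda>p. of_int (sign p) * (\<Prod>i\<in>UNIV. A $ i $ p i)"
  have inj: "inj e" and e: "bij_betw e UNIV UNIV" using assms by (auto simp: bij_betw_def)
  have "det A = (\<Sum>p | p permutes UNIV. ?P p)"
    by (simp add: det_def)
  also have "\<dots> = (\<Sum>q | q permutes (UNIV::'m set). ?P (map_permutation UNIV e q))"
  proof (rule sum.reindex_bij_witness[of _ "map_permutation UNIV e" "map_permutation UNIV (inv e)"])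
    fix p :: "'n \<Rightarrow> 'n" assume "p \<in> {p. p permutes UNIV}"
    then have p: "p permutes UNIV" by simp
    have ie: "bij (inv e)" using assms by (simp add: bij_imp_bij_inv)
    show "map_permutation UNIV e (map_permutation UNIV (inv e) p) = p"
      by (rule map_permutation_compose_inv[OF ie])
        (use p assms in \<open>auto simp: bij_is_surj surj_f_inv_f\<close>)
    show "map_permutation UNIV (inv e) p \<in> {q. q permutes UNIV}"
      using map_permutation_permutes[OF ie p] by simp
    show "?P (map_permutation UNIV e (map_permutation UNIV (inv e) p)) = ?P p"
      using \<open>map_permutation UNIV e (map_permutation UNIV (inv e) p) = p\<close> by simp
  next
    fix q :: "'m \<Rightarrow> 'm" assume "q \<in> {q. q permutes UNIV}"
    then have q: "q permutes UNIV" by simp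
    show "map_permutation UNIV (inv e) (map_permutation UNIV e q) = q"
      by (rule map_permutation_compose_inv[OF e]) (use q inj in auto)
    show "map_permutation UNIV e q \<in> {q. q permutes UNIV}"
      using map_permutation_permutes[OF e q] by simp
  qed
  also have "\<dots> = (\<Sum>q | q permutes (UNIV::'m set). of_int (sign q) * (\<Prod>i\<in>UNIV. A $ e i $ e (q i)))"
  proof (rule sum.cong[OF refl])
    fix q :: "'m \<Rightarrow> 'm" assume "q \<in> {q. q permutes UNIV}"
    then have q: "q permutes UNIV" by simp
    have "(\<Prod>i\<in>UNIV. A $ i $ map_permutation UNIV e q i)
        = (\<Prod>i\<in>UNIV. A $ e i $ map_permutation UNIV e q (e i))"
      by (rule prod.reindex_bij_betw[OF e, symmetric])
    then show "?P (map_permutation UNIV e q) = of_int (sign q) * (\<Prod>i\<in>UNIV. A $ e i $ e (q i))"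
      using inj q by (simp add: map_permutation_apply sign_map_permutation)
  qed
  also have "\<dots> = det (\<chi> i j. A $ e i $ e j)"
    by (simp add: det_def)
  finally show ?thesis ..
qed

definition reindex :: "('m \<Rightarrow> 'n) \<Rightarrow> 'a ^ 'n \<Rightarrow> 'a ^ 'm" where
  "reindex e x = (\<chi> i. x $ e i)"

lemma reindex_nth [simp]: "reindex e x $ i = x $ e i"
  by (simp add: reindex_def)

lemma reindex_inv [simp]:
  assumes "bij e"
  shows "reindex (inv e) (reindex e x) = x" "reindex e (reindex (inv e) y) = y"
  using assms by (simp_all add: vec_eq_iff bij_is_inj bij_is_surj surj_f_inv_f)

lemma bounded_linear_reindex: "bounded_linear (reindex e :: real ^ 'n \<Rightarrow> real ^ 'm)"
  by (auto intro!: linear_conv_bounded_linear[THEN iffD1] linearI simp: vec_eq_iff)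

lemma borel_measurable_reindex:
  "(reindex e :: real ^ 'n \<Rightarrow> real ^ 'm) \<in> borel_measurable borel"
  by (intro borel_measurable_continuous_onI linear_continuous_on bounded_linear_reindex)

text \<open>Permuting coordinates maps boxes to boxes with the same side lengths, and Lebesgue measure
  is determined by its values on boxes.\<close>

lemma distr_lborel_reindex:
  fixes e :: "'m::finite \<Rightarrow> 'n::finite"
  assumes "bij e"
  shows "distr lborel lborel (reindex e) = (lborel :: (real ^ 'm) measure)"
proof -
  have prod: "(\<Prod>b\<in>Basis. x \<bullet> b) = (\<Prod>i\<in>UNIV. x $ i)" for x :: "real ^ 'k"
  proof -
    have "(\<Prod>b\<in>Basis. x \<bullet> b) = (\<Prod>b\<in>range (\<lambda>i::'k. axis i (1::real)). x \<bullet> b)"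
      by (rule prod.cong) (auto simp: Basis_vec_def)
    also have "\<dots> = (\<Prod>i\<in>UNIV. x $ i)"
      by (subst prod.reindex) (auto simp: inj_on_def axis_eq_axis inner_axis)
    finally show ?thesis .
  qed
  have meas: "reindex e \<in> borel_measurable (lborel :: (real ^ 'n) measure)"
    using borel_measurable_reindex by simp
  have "lborel = distr lborel lborel (reindex e :: real ^ 'n \<Rightarrow> real ^ 'm)"
  proof (rule lborel_eqI)
    fix l u :: "real ^ 'm"
    assume le: "\<And>b. b \<in> Basis \<Longrightarrow> l \<bullet> b \<le> u \<bullet> b"
    have le': "l $ i \<le> u $ i" for i
      using le[of "axis i 1"] by (simp add: inner_axis)
    have "reindex e -` box l u = box (reindex (inv e) l) (reindex (inv e) u)"
      using assms by (auto simp: mem_box_cart bij_is_inj) (metis bij_inv_eq_iff)+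
    then have "emeasure (distr lborel lborel (reindex e)) (box l u)
        = emeasure lborel (box (reindex (inv e) l) (reindex (inv e) u))"
      using meas by (simp add: emeasure_distr)
    also have "\<dots> = (\<Prod>b\<in>Basis. (reindex (inv e) u - reindex (inv e) l) \<bullet> b)"
      using le' by (subst emeasure_lborel_box) (auto simp: Basis_vec_def inner_axis)
    also have "(\<Prod>b\<in>Basis. (reindex (inv e) u - reindex (inv e) l) \<bullet> b)
        = (\<Prod>i\<in>UNIV. (u - l) $ inv e i)"
      by (simp add: prod)
    also have "\<dots> = (\<Prod>i\<in>UNIV. (u - l) $ i)"
      by (rule prod.reindex_bij_betw) (use assms bij_imp_bij_inv in blast)
    finally show "emeasure (distr lborel lborel (reindex e)) (box l u) = (\<Prod>b\<in>Basis. (u - l) \<bullet> b)"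
      by (simp add: prod)
  qed simp
  then show ?thesis ..
qed

lemma
  fixes e :: "'m::finite \<Rightarrow> 'n::finite"
  assumes "bij e"
  shows measurable_lebesgue_reindex:
      "reindex e \<in> (lebesgue :: (real ^ 'n) measure) \<rightarrow>\<^sub>M (lebesgue :: (real ^ 'm) measure)"
    and distr_lebesgue_reindex:
      "distr lebesgue lebesgue (reindex e) = (lebesgue :: (real ^ 'm) measure)"
proof -
  have "reindex e \<in> borel_measurable (lborel :: (real ^ 'n) measure)"
    using borel_measurable_reindex by simp
  then have m0: "reindex e \<in> (lborel :: (real ^ 'n) measure) \<rightarrow>\<^sub>M (lborel :: (real ^ 'm) measure)"
    by simp
  then have m: "reindex e \<in> (lebesgue :: (real ^ 'n) measure) \<rightarrow>\<^sub>M (lborel :: (real ^ 'm) measure)"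
    by (rule measurable_completion)
  have d: "distr lebesgue lborel (reindex e) = (lborel :: (real ^ 'm) measure)"
    using distr_completion[OF m0] distr_lborel_reindex[OF assms] by simp
  show "reindex e \<in> (lebesgue :: (real ^ 'n) measure) \<rightarrow>\<^sub>M (lebesgue :: (real ^ 'm) measure)"
    by (rule completion.measurable_completion2[OF m]) (simp add: d)
  show "distr lebesgue lebesgue (reindex e) = (lebesgue :: (real ^ 'm) measure)"
    using completion.completion_distr_eq[OF m] by (simp add: d)
qed

lemma
  fixes e :: "'m::finite \<Rightarrow> 'n::finite" and f :: "real ^ 'm \<Rightarrow> real"
  assumes e: "bij e"
  shows integrable_lebesgue_reindex:
      "integrable lebesgue (\<lambda>x. f (reindex e x)) \<longleftrightarrow> integrable lebesgue f"
    and integral_lebesgue_reindex: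
      "integrable lebesgue f \<Longrightarrow> (LINT x|lebesgue. f (reindex e x)) = (LINT y|lebesgue. f y)"
proof -
  have *: "integrable lebesgue (\<lambda>x. f (reindex d x))" if "integrable lebesgue f" "bij d"
    for d :: "'k::finite \<Rightarrow> 'l::finite" and f :: "real ^ 'k \<Rightarrow> real"
    using integrable_distr[OF measurable_lebesgue_reindex[OF that(2)], of f] that
    by (simp add: distr_lebesgue_reindex)
  show "integrable lebesgue (\<lambda>x. f (reindex e x)) \<longleftrightarrow> integrable lebesgue f"
    using *[of f e] *[of "\<lambda>x. f (reindex e x)" "inv e"] e by (auto simp: bij_imp_bij_inv)
  show "(LINT x|lebesgue. f (reindex e x)) = (LINT y|lebesgue. f y)" if "integrable lebesgue f"
    using integral_distr[OF measurable_lebesgue_reindex[OF e], of f] that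
    by (simp add: distr_lebesgue_reindex[OF e])
qed

text \<open>The change-of-variables theorem for \<^typ>\<open>real ^ 'n\<close> asks for a well-ordered index
  type. A copy of a finite type, ordered by its injection \<^const>\<open>to_nat\<close> into the naturals, is one,
  so relabelling the coordinates by this copy carries the theorem over to every finite index
  type.\<close>

typedef 'a :: finite enumerated = "UNIV :: 'a set" ..

lemma bij_Abs_enumerated: "bij Abs_enumerated"
  by (rule bijI') (auto simp: Abs_enumerated_inject intro: Rep_enumerated_inverse[symmetric])

instance enumerated :: (finite) finite
proof
  have "finite (range (Abs_enumerated :: 'a \<Rightarrow> _))" by simp
  then show "finite (UNIV :: 'a enumerated set)"
    using bij_is_surj[OF bij_Abs_enumerated] by metis
qed

instantiation enumerated :: (finite) wellorder
begin

definition "x \<le> y \<longleftrightarrow> to_nat x \<le> to_nat y" for x y :: "'a enumerated"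
definition "x < y \<longleftrightarrow> to_nat x < to_nat y" for x y :: "'a enumerated"

instance
proof
  fix P :: "'a enumerated \<Rightarrow> bool" and a :: "'a enumerated"
  assume step: "\<And>x. (\<And>y. y < x \<Longrightarrow> P y) \<Longrightarrow> P x"
  show "P a"
    by (induction a rule: measure_induct_rule[of to_nat]) (metis step less_enumerated_def)
qed (auto simp: less_eq_enumerated_def less_enumerated_def)

end

section \<open>Change of variables under differentiable bijections\<close>

lemma change_of_variables_wellorder:
  fixes f :: "real ^ 'n::{finite,wellorder} \<Rightarrow> real" and g :: "real ^ 'n::_ \<Rightarrow> real ^ 'n::_"
  assumes "\<And>x. (g has_derivative g' x) (at x)" and "bij g" and "integrable lebesgue f"
  shows "integrable lebesgue (\<lambda>x. \<bar>det (matrix (g' x))\<bar> * f (g x))"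
    and "(LINT x|lebesgue. \<bar>det (matrix (g' x))\<bar> * f (g x)) = (LINT y|lebesgue. f y)"
proof -
  have int: "h absolutely_integrable_on UNIV \<longleftrightarrow> integrable lebesgue h" for h :: "real ^ 'n::_ \<Rightarrow> real"
    by (simp add: set_integrable_def)
  have eq: "integral UNIV h = (LINT x|lebesgue. h x)" if "integrable lebesgue h"
    for h :: "real ^ 'n::_ \<Rightarrow> real"
    using set_lebesgue_integral_eq_integral(2)[of UNIV h] that int[of h]
    by (simp add: set_lebesgue_integral_def)
  \<comment> \<open>The vector-valued theorem, read in dimension one.\<close>
  have "(\<lambda>x. \<bar>det (matrix (g' x))\<bar> *\<^sub>R (vec (f (g x)) :: real ^ 1)) absolutely_integrable_on UNIV \<and>
      integral UNIV (\<lambda>x. \<bar>det (matrix (g' x))\<bar> *\<^sub>R (vec (f (g x)) :: real ^ 1)) = vec (integral UNIV f) \<longleftrightarrow>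
      (\<lambda>y. vec (f y) :: real ^ 1) absolutely_integrable_on (g ` UNIV) \<and>
      integral (g ` UNIV) (\<lambda>y. vec (f y) :: real ^ 1) = vec (integral UNIV f)"
    by (rule has_absolute_integral_change_of_variables)
      (use assms in \<open>auto simp: bij_is_inj\<close>)
  then have "integrable lebesgue (\<lambda>x. \<bar>det (matrix (g' x))\<bar> * f (g x)) \<and>
      integral UNIV (\<lambda>x. \<bar>det (matrix (g' x))\<bar> * f (g x)) = integral UNIV f"
    using assms by (simp add: bij_is_surj absolutely_integrable_on_1_iff integral_on_1_eq vec_eq_iff
        int del: vec_scaleR)
  then show "integrable lebesgue (\<lambda>x. \<bar>det (matrix (g' x))\<bar> * f (g x))"
    and "(LINT x|lebesgue. \<bar>det (matrix (g' x))\<bar> * f (g x)) = (LINT y|lebesgue. f y)"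
    using eq assms(3) by auto
qed

text \<open>In relabelled coordinates \<open>g\<close> becomes \<open>R \<circ> g \<circ> R\<inverse>\<close>, where \<open>R\<close> preserves
  Lebesgue measure and conjugation by \<open>R\<close> does not change determinants.\<close>

lemma change_of_variables:
  fixes f :: "real ^ 'n::finite \<Rightarrow> real" and g :: "real ^ 'n \<Rightarrow> real ^ 'n"
  assumes g': "\<And>x. (g has_derivative g' x) (at x)" and "bij g" and f: "integrable lebesgue f"
  shows "integrable lebesgue (\<lambda>x. \<bar>det (matrix (g' x))\<bar> * f (g x))"
    and "(LINT x|lebesgue. \<bar>det (matrix (g' x))\<bar> * f (g x)) = (LINT y|lebesgue. f y)"
proof -
  define e where "e = (Rep_enumerated :: 'n enumerated \<Rightarrow> 'n)"
  have e: "bij e"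
    unfolding e_def
    by (rule bijI') (auto simp: Rep_enumerated_inject intro: Abs_enumerated_inverse[symmetric])
  have ie: "bij (inv e)" using e by (rule bij_imp_bij_inv)
  let ?R = "reindex e :: real ^ 'n \<Rightarrow> real ^ 'n enumerated"
  let ?S = "reindex (inv e) :: real ^ 'n enumerated \<Rightarrow> real ^ 'n"
  define h where "h = (\<lambda>x. \<bar>det (matrix (g' x))\<bar> * f (g x))"
  have D: "((\<lambda>x. ?R (g (?S x))) has_derivative (\<lambda>z. ?R (g' (?S x) (?S z)))) (at x)" for x
  proof -
    have "(?S has_derivative ?S) (at x)"
      by (rule bounded_linear.has_derivative[OF bounded_linear_reindex]) simp
    from has_derivative_compose[OF this g']
    show ?thesis
      by (rule bounded_linear.has_derivative[OF bounded_linear_reindex])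
  qed
  have bij: "bij (\<lambda>x. ?R (g (?S x)))"
    by (rule o_bij[where g = "\<lambda>x. ?R (inv g (?S x))"])
      (use \<open>bij g\<close> e in \<open>auto simp: fun_eq_iff bij_is_inj bij_is_surj surj_f_inv_f\<close>)
  have fS: "integrable lebesgue (\<lambda>y. f (?S y))"
    using f by (simp add: integrable_lebesgue_reindex[OF ie])
  have det: "det (matrix (\<lambda>z. ?R (g' (?S x) (?S z)))) = det (matrix (g' (?S x)))" for x
  proof -
    have "inv e i = j \<longleftrightarrow> i = e j" for i j
      using e by (metis bij_inv_eq_iff)
    then have S: "?S (axis j 1) = axis (e j) 1" for j
      by (simp add: vec_eq_iff axis_def)
    have "matrix (\<lambda>z. ?R (g' (?S x) (?S z))) = (\<chi> i j. matrix (g' (?S x)) $ e i $ e j)"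
      unfolding matrix_def S by (simp add: vec_eq_iff)
    then show ?thesis
      using det_reindex[OF e] by simp
  qed
  have "integrable lebesgue (\<lambda>x. h (?S x))"
    and "(LINT x|lebesgue. h (?S x)) = (LINT y|lebesgue. f (?S y))"
    using change_of_variables_wellorder[OF D bij fS] e by (simp_all add: h_def det)
  then show "integrable lebesgue (\<lambda>x. \<bar>det (matrix (g' x))\<bar> * f (g x))"
    and "(LINT x|lebesgue. \<bar>det (matrix (g' x))\<bar> * f (g x)) = (LINT y|lebesgue. f y)"
    using integral_lebesgue_reindex[OF ie, of h] integral_lebesgue_reindex[OF ie, of f] f
    by (simp_all add: integrable_lebesgue_reindex[OF ie] h_def[symmetric])
qed

lemma jacobian_change_of_variables:
  fixes f :: "real ^ 'n::finite \<Rightarrow> real" and \<phi> :: "real ^ 'n \<Rightarrow> real ^ 'n"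
  assumes "bij \<phi>" and diff: "\<And>x. \<phi> differentiable (at x)" and f: "integrable lebesgue f"
  shows "integrable lebesgue (\<lambda>x. \<bar>det (jacobian \<phi> (at x))\<bar> * f (\<phi> x))"
    and "(LINT x|lebesgue. \<bar>det (jacobian \<phi> (at x))\<bar> * f (\<phi> x)) = (LINT y|lebesgue. f y)"
  using change_of_variables[of \<phi> "\<lambda>x. frechet_derivative \<phi> (at x)" f] assms
  by (simp_all add: jacobian_def frechet_derivative_works)

text \<open>The preimage of \<open>S\<close> under \<open>inv \<phi>\<close> is \<open>\<phi> ` S\<close>, and differentiable maps send Lebesgue
  sets to Lebesgue sets and null sets to null sets.\<close>

lemma
  fixes \<phi> :: "'a::euclidean_space \<Rightarrow> 'a" and g :: "'a \<Rightarrow> real"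
  assumes bij: "bij \<phi>" and diff: "\<And>x. \<phi> differentiable (at x)"
    and g: "g \<in> borel_measurable lebesgue"
  shows borel_measurable_lebesgue_inv_diffeo: "(\<lambda>y. g (inv \<phi> y)) \<in> borel_measurable lebesgue"
    and ess_bounded_inv_diffeo:
      "(AE x in lebesgue. \<bar>g x\<bar> \<le> C) \<Longrightarrow> (AE y in lebesgue. \<bar>g (inv \<phi> y)\<bar> \<le> C)"
proof -
  have d: "\<phi> differentiable_on S" for S
    using diff by (auto simp: differentiable_on_def intro: differentiable_at_withinI)
  have vimage: "inv \<phi> -` S = \<phi> ` S" for S
    using bij by (simp add: bij_vimage_eq_inv_image bij_imp_bij_inv inv_inv_eq)
  show "(\<lambda>y. g (inv \<phi> y)) \<in> borel_measurable lebesgue"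
  proof (rule measurableI)
    fix B :: "real set" assume "B \<in> sets borel"
    then have "g -` B \<in> sets lebesgue" using measurable_sets[OF g] by force
    then have "\<phi> ` (g -` B) \<in> sets lebesgue"
      by (rule differentiable_image_in_sets_lebesgue) (use d in auto)
    moreover have "(\<lambda>y. g (inv \<phi> y)) -` B = \<phi> ` (g -` B)"
      using vimage[of "g -` B"] by (auto simp: vimage_def)
    ultimately show "(\<lambda>y. g (inv \<phi> y)) -` B \<inter> space lebesgue \<in> sets lebesgue" by simp
  qed simp
  assume "AE x in lebesgue. \<bar>g x\<bar> \<le> C"
  then obtain N where N: "{x. \<not> \<bar>g x\<bar> \<le> C} \<subseteq> N" "N \<in> null_sets lebesgue"
    by (auto elim!: AE_E simp: null_sets_def)
  then have "\<phi> ` N \<in> null_sets lebesgue"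
    using negligible_differentiable_image_negligible[OF order_refl _ d, of N]
    by (simp add: negligible_iff_null_sets)
  moreover have "{y \<in> space lebesgue. \<not> \<bar>g (inv \<phi> y)\<bar> \<le> C} \<subseteq> \<phi> ` N"
    using N(1) vimage[of N] by auto
  ultimately show "AE y in lebesgue. \<bar>g (inv \<phi> y)\<bar> \<le> C" by (rule AE_I')
qed

section \<open>Uniform boundedness in the dual of \<open>L\<^sup>1\<close>\<close>

lemma sigma_finite_lebesgue: "sigma_finite_measure (lebesgue :: 'a::euclidean_space measure)"
proof
  show "\<exists>A::'a set set. countable A \<and> A \<subseteq> sets lebesgue \<and> \<Union>A = space lebesgue \<and>
      (\<forall>a\<in>A. emeasure lebesgue a \<noteq> \<infinity>)"
    by (intro exI[of _ "range (\<lambda>n::nat. box (- real n *\<^sub>R One) (real n *\<^sub>R One))"])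
      (auto simp: emeasure_lborel_box_eq UN_box_eq_UNIV)
qed

text \<open>The witness is \<open>sgn g\<close> on the set where \<open>\<bar>g\<bar> > D\<close>, weighted by a strictly positive
  integrable function, as that set may have infinite measure, and normalised to mass one.\<close>

lemma (in sigma_finite_measure) exists_nearly_norming_integrable:
  fixes g :: "'a \<Rightarrow> real"
  assumes [measurable]: "g \<in> borel_measurable M" and bdd: "AE x in M. \<bar>g x\<bar> \<le> C"
    and "0 \<le> D" and not_le: "\<not> (AE x in M. \<bar>g x\<bar> \<le> D)"
  obtains f where "integrable M f" "(LINT x|M. \<bar>f x\<bar>) \<le> 1" "D \<le> (LINT x|M. g x * f x)"
proof -
  obtain h :: "'a \<Rightarrow> real" where [measurable]: "h \<in> borel_measurable M"
    and h: "\<And>x. 0 < h x" "integrable M h"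
    using obtain_positive_integrable_function by metis
  define A where "A = {x \<in> space M. D < \<bar>g x\<bar>}"
  have [measurable]: "A \<in> sets M" unfolding A_def by measurable
  define k where "k = (\<lambda>x. h x * indicator A x)"
  have [measurable]: "k \<in> borel_measurable M" unfolding k_def by measurable
  have k: "integrable M k" unfolding k_def
    using h(2) by (rule Bochner_Integration.integrable_bound) (auto simp: indicator_def)
  have k0: "0 \<le> k x" for x using less_imp_le[OF h(1)] by (simp add: k_def)
  define c where "c = integral\<^sup>L M k"
  have "c \<noteq> 0"
  proof
    assume "c = 0"
    then have "AE x in M. k x = 0"
      using integral_nonneg_eq_0_iff_AE[OF k] k0 by (simp add: c_def)
    then have "AE x in M. \<bar>g x\<bar> \<le> D"
      by (rule AE_mp) (use h(1) in \<open>auto simp: k_def A_def indicator_def not_less intro!: AE_I2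
        split: if_splits dest: less_imp_neq[THEN not_sym]\<close>)
    with not_le show False by simp
  qed
  moreover have "0 \<le> c" unfolding c_def by (simp add: k0)
  ultimately have c: "0 < c" by simp
  define f where "f = (\<lambda>x. sgn (g x) * k x / c)"
  have [measurable]: "f \<in> borel_measurable M" unfolding f_def by measurable
  have f: "integrable M f"
    by (rule Bochner_Integration.integrable_bound[of M "\<lambda>x. k x / c"])
      (use k k0 c in \<open>auto simp: f_def abs_mult abs_sgn_eq\<close>)
  have fk: "\<bar>f x\<bar> \<le> k x / c" for x
    using k0[of x] c by (simp add: f_def abs_mult abs_sgn_eq)
  have "(LINT x|M. \<bar>f x\<bar>) \<le> (LINT x|M. k x / c)"
    by (rule integral_mono) (use f k fk in auto)
  also have "\<dots> = 1" using c by (simp add: c_def)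
  finally have 1: "(LINT x|M. \<bar>f x\<bar>) \<le> 1" .
  have gf: "integrable M (\<lambda>x. g x * f x)"
    by (rule Bochner_Integration.integrable_bound[of M "\<lambda>x. C * f x"])
      (use f bdd in \<open>auto simp: abs_mult intro!: mult_right_mono\<close>)
  have "D = (LINT x|M. D * (k x / c))" using c by (simp add: c_def)
  also have "\<dots> \<le> (LINT x|M. g x * f x)"
  proof (rule integral_mono)
    show "integrable M (\<lambda>x. D * (k x / c))" using k by simp
    show "integrable M (\<lambda>x. g x * f x)" by fact
    fix x assume x: "x \<in> space M"
    have "g x * f x = \<bar>g x\<bar> * (k x / c)"
      by (simp add: f_def abs_sgn mult.assoc)
    moreover have "D * (k x / c) \<le> \<bar>g x\<bar> * (k x / c)"
    proof (cases "x \<in> A")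
      case True then show ?thesis
        using k0[of x] c by (intro mult_right_mono) (auto simp: A_def)
    qed (simp add: k_def)
    ultimately show "D * (k x / c) \<le> g x * f x" by simp
  qed
  finally show thesis by (rule that[OF f 1])
qed

lemma integrable_suminf_of_summable_norms:
  fixes z :: "nat \<Rightarrow> 'a \<Rightarrow> real"
  assumes z: "\<And>i. integrable M (z i)" and sum: "summable (\<lambda>i. LINT x|M. \<bar>z i x\<bar>)"
  shows "AE x in M. summable (\<lambda>i. \<bar>z i x\<bar>)"
    and "integrable M (\<lambda>x. \<Sum>i. z i x)"
    and "(LINT x|M. \<bar>\<Sum>i. z i x\<bar>) \<le> (\<Sum>i. LINT x|M. \<bar>z i x\<bar>)"
proof -
  have [measurable]: "z i \<in> borel_measurable M" for i using z by auto
  have "(\<integral>\<^sup>+x. (\<Sum>i. ennreal \<bar>z i x\<bar>) \<partial>M) = (\<Sum>i. \<integral>\<^sup>+x. ennreal \<bar>z i x\<bar> \<partial>M)"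
    by (rule nn_integral_suminf) simp
  also have "\<dots> = (\<Sum>i. ennreal (LINT x|M. \<bar>z i x\<bar>))"
    using z by (simp add: nn_integral_eq_integral)
  also have "\<dots> = ennreal (\<Sum>i. LINT x|M. \<bar>z i x\<bar>)"
    by (rule suminf_ennreal2) (use sum in auto)
  finally have "AE x in M. (\<Sum>i. ennreal \<bar>z i x\<bar>) \<noteq> \<infinity>"
    by (intro nn_integral_noteq_infinite) auto
  then show ae: "AE x in M. summable (\<lambda>i. \<bar>z i x\<bar>)"
    by (rule AE_mp) (auto intro!: AE_I2 summable_suminf_not_top)
  show "integrable M (\<lambda>x. \<Sum>i. z i x)"
    by (rule integrable_suminf) (use z ae sum in auto)
  then have "(LINT x|M. \<bar>\<Sum>i. z i x\<bar>) \<le> (LINT x|M. (\<Sum>i. \<bar>z i x\<bar>))"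
  proof (intro integral_mono_AE)
    show "integrable M (\<lambda>x. \<Sum>i. \<bar>z i x\<bar>)"
      by (rule integrable_suminf) (use z ae sum in auto)
    show "AE x in M. \<bar>\<Sum>i. z i x\<bar> \<le> (\<Sum>i. \<bar>z i x\<bar>)"
      using ae by (rule AE_mp) (auto intro!: AE_I2 summable_rabs)
  qed auto
  also have "\<dots> = (\<Sum>i. LINT x|M. \<bar>z i x\<bar>)"
    by (rule integral_suminf) (use z ae sum in auto)
  finally show "(LINT x|M. \<bar>\<Sum>i. z i x\<bar>) \<le> (\<Sum>i. LINT x|M. \<bar>z i x\<bar>)" .
qed

lemma
  fixes g f :: "'a \<Rightarrow> real"
  assumes [measurable]: "g \<in> borel_measurable M" and f: "integrable M f"
    and g: "AE x in M. \<bar>g x\<bar> \<le> C"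
  shows integrable_mult_ess_bounded: "integrable M (\<lambda>x. g x * f x)"
    and abs_integral_mult_ess_bounded: "\<bar>LINT x|M. g x * f x\<bar> \<le> C * (LINT x|M. \<bar>f x\<bar>)"
proof -
  show i: "integrable M (\<lambda>x. g x * f x)"
    by (rule Bochner_Integration.integrable_bound[of M "\<lambda>x. C * f x"])
      (use f g in \<open>auto simp: abs_mult intro!: mult_right_mono\<close>)
  have "\<bar>LINT x|M. g x * f x\<bar> \<le> (LINT x|M. \<bar>g x * f x\<bar>)"
    by (rule integral_abs_bound)
  also have "\<dots> \<le> (LINT x|M. C * \<bar>f x\<bar>)"
    by (rule integral_mono_AE) (use f g integrable_abs[OF i] in \<open>auto simp: abs_mult intro!: mult_right_mono\<close>)
  finally show "\<bar>LINT x|M. g x * f x\<bar> \<le> C * (LINT x|M. \<bar>f x\<bar>)" by simp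
qed

text \<open>This is the Banach--Steinhaus theorem for the functionals \<open>f \<mapsto> \<integral> g\<^sub>n f\<close> on \<open>L\<^sup>1\<close>, by a
  gliding hump in place of Baire's theorem. If the essential bounds were unbounded, one could add
  up \<open>\<plusminus> 3\<^sup>-\<^sup>k f\<^sub>k\<close>, each \<open>f\<^sub>k\<close> nearly norming a functional of huge norm \<open>D\<^sub>k\<close>. Of the two
  values at \<open>X \<plusminus> y\<close> of a linear functional, one is at least as large as its value at \<open>y\<close>, so
  a choice of sign makes the \<open>k\<close>-th partial sum worth \<open>3\<^sup>-\<^sup>k D\<^sub>k\<close>; the later terms have total
  norm \<open>3\<^sup>-\<^sup>k / 2\<close> and cannot cancel this.\<close>

theorem (in sigma_finite_measure) ess_bounded_if_pointwise_bounded: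
  fixes g :: "nat \<Rightarrow> 'a \<Rightarrow> real"
  assumes meas [measurable]: "\<And>n. g n \<in> borel_measurable M"
    and ess: "\<And>n. \<exists>C. AE x in M. \<bar>g n x\<bar> \<le> C"
    and bdd: "\<And>f. integrable M f \<Longrightarrow> bounded (range (\<lambda>n. LINT x|M. g n x * f x))"
  shows "\<exists>C. \<forall>n. AE x in M. \<bar>g n x\<bar> \<le> C"
proof (rule ccontr)
  assume "\<not> (\<exists>C. \<forall>n. AE x in M. \<bar>g n x\<bar> \<le> C)"
  then have unbounded: "\<exists>n. \<not> (AE x in M. \<bar>g n x\<bar> \<le> C)" for C
    by blast
  have hump: "\<exists>n D f. C \<le> D \<and> integrable M f \<and> (LINT x|M. \<bar>f x\<bar>) \<le> 1 \<and>
      D \<le> (LINT x|M. g n x * f x) \<and> (AE x in M. \<bar>g n x\<bar> \<le> 3/2 * D)" if "0 < C" for C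
  proof -
    obtain n where n: "\<not> (AE x in M. \<bar>g n x\<bar> \<le> C)" using unbounded by blast
    obtain B where B: "AE x in M. \<bar>g n x\<bar> \<le> B" using ess by blast
    \<comment> \<open>The last level \<open>C (3/2)\<^sup>i\<close> that is not an essential bound is within the factor 3/2 of one.\<close>
    let ?Q = "\<lambda>j. AE x in M. \<bar>g n x\<bar> \<le> C * (3/2) ^ j"
    obtain j where "B / C < (3/2) ^ j" using real_arch_pow[of "3/2"] by auto
    then have "B \<le> C * (3/2) ^ j" using that by (simp add: divide_less_eq mult.commute)
    then have "?Q j" using B by (auto elim: order_trans)
    moreover have "\<not> ?Q 0" using n by simp
    ultimately obtain i where i: "\<not> ?Q i" "?Q (Suc i)"
      using exists_least_lemma[of ?Q] by blast
    define D where "D = C * (3/2) ^ i"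
    have "C \<le> D"
      using that mult_left_mono[OF one_le_power[of "3/2 :: real" i], of C] by (simp add: D_def)
    have "0 \<le> D" using that \<open>C \<le> D\<close> by simp
    obtain f where "integrable M f" "(LINT x|M. \<bar>f x\<bar>) \<le> 1" "D \<le> (LINT x|M. g n x * f x)"
      by (rule exists_nearly_norming_integrable[OF meas B \<open>0 \<le> D\<close> i(1)[folded D_def]])
    moreover have "AE x in M. \<bar>g n x\<bar> \<le> 3/2 * D"
      using i(2) by (simp add: D_def mult_ac)
    ultimately show ?thesis using \<open>C \<le> D\<close> by blast
  qed
  \<comment> \<open>The factor \<open>3\<^sup>k\<close> beats the weight of \<open>f\<^sub>k\<close>; of \<open>3\<^sup>-\<^sup>k D\<^sub>k\<close> the tail takes at most
    three quarters, hence the factor 4.\<close>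
  define R where "R k n D f \<longleftrightarrow> 4 * 3 ^ k * (real k + 1) \<le> D \<and> integrable M f \<and> (LINT x|M. \<bar>f x\<bar>) \<le> 1 \<and>
      D \<le> (LINT x|M. g n x * f x) \<and> (AE x in M. \<bar>g n x\<bar> \<le> 3/2 * D)" for k n D f
  have "\<exists>n D f. R k n D f" for k
    unfolding R_def by (rule hump) simp
  then obtain n D f where R: "\<And>k. R k (n k) (D k) (f k)" by metis
  then have D: "\<And>k. 4 * 3 ^ k * (real k + 1) \<le> D k"
    and f [simp]: "\<And>k. integrable M (f k)" and f1: "\<And>k. (LINT x|M. \<bar>f k x\<bar>) \<le> 1"
    and gf: "\<And>k. D k \<le> (LINT x|M. g (n k) x * f k x)"
    and g: "\<And>k. AE x in M. \<bar>g (n k) x\<bar> \<le> 3/2 * D k"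
    by (simp_all add: R_def)
  define X where "X = rec_nat (\<lambda>_. 0) (\<lambda>k X. if D k / 3 ^ k \<le> \<bar>LINT x|M. g (n k) x * (X x + f k x / 3 ^ k)\<bar>
      then (\<lambda>x. X x + f k x / 3 ^ k) else (\<lambda>x. X x - f k x / 3 ^ k))"
  have X0: "X 0 = (\<lambda>_. 0)" by (simp add: X_def)
  have XS: "X (Suc k) = (if D k / 3 ^ k \<le> \<bar>LINT x|M. g (n k) x * (X k x + f k x / 3 ^ k)\<bar>
      then (\<lambda>x. X k x + f k x / 3 ^ k) else (\<lambda>x. X k x - f k x / 3 ^ k))" for k
    by (simp add: X_def)
  have X [simp]: "integrable M (X k)" for k
    by (induction k) (simp_all add: X0 XS)
  have gX: "integrable M (\<lambda>x. g (n k) x * h x)" if "integrable M h" for k h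
    by (rule integrable_mult_ess_bounded[OF meas that g])
  have large: "D k / 3 ^ k \<le> \<bar>LINT x|M. g (n k) x * X (Suc k) x\<bar>" for k
  proof -
    let ?a = "LINT x|M. g (n k) x * X k x" and ?b = "LINT x|M. g (n k) x * (f k x / 3 ^ k)"
    have b: "D k / 3 ^ k \<le> ?b"
      using gf[of k] by (simp add: divide_right_mono)
    have p: "(LINT x|M. g (n k) x * (X k x + f k x / 3 ^ k)) = ?a + ?b"
      using gX[of "X k" k] gX[of "\<lambda>x. f k x / 3 ^ k" k] by (simp add: ring_distribs)
    have m: "(LINT x|M. g (n k) x * (X k x - f k x / 3 ^ k)) = ?a - ?b"
      using gX[of "X k" k] gX[of "\<lambda>x. f k x / 3 ^ k" k] by (simp add: right_diff_distrib)
    show ?thesis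
    proof (cases "D k / 3 ^ k \<le> \<bar>?a + ?b\<bar>")
      case True then show ?thesis by (simp only: XS p if_True)
    next
      case False
      then have "D k / 3 ^ k \<le> \<bar>?a - ?b\<bar>" using b by linarith
      then show ?thesis using False by (simp only: XS p m if_False)
    qed
  qed
  define z where "z = (\<lambda>k x. X (Suc k) x - X k x)"
  have z [simp]: "integrable M (z k)" for k by (simp add: z_def)
  have "\<bar>z k x\<bar> = \<bar>f k x\<bar> / 3 ^ k" for k x by (simp add: z_def XS)
  then have z1: "(LINT x|M. \<bar>z k x\<bar>) \<le> (1/3) ^ k" for k
    using f1[of k] by (simp add: divide_right_mono power_one_over)
  have sums: "summable (\<lambda>i. LINT x|M. \<bar>z (i + m) x\<bar>)" for m
    by (rule summable_comparison_test'[where N = 0 and g = "\<lambda>i. (1/3::real) ^ (i + m)"])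
      (use z1 in \<open>auto simp: power_add[symmetric] summable_iff_shift intro!: summable_geometric\<close>)
  define F where "F = (\<lambda>x. \<Sum>i. z i x)"
  have F [simp]: "integrable M F"
    unfolding F_def by (rule integrable_suminf_of_summable_norms) (use sums[of 0] in auto)
  have tail: "(LINT x|M. \<bar>F x - X (Suc k) x\<bar>) \<le> 1 / (2 * 3 ^ k)" for k
  proof -
    have "AE x in M. summable (\<lambda>i. \<bar>z i x\<bar>)"
      by (rule integrable_suminf_of_summable_norms) (use sums[of 0] in auto)
    then have "AE x in M. F x - X (Suc k) x = (\<Sum>i. z (i + Suc k) x)"
    proof (rule AE_mp, intro AE_I2 impI)
      fix x assume "summable (\<lambda>i. \<bar>z i x\<bar>)"
      then have "summable (\<lambda>i. z i x)" by (rule summable_rabs_cancel)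
      from suminf_split_initial_segment[OF this, of "Suc k"]
      have "F x = (\<Sum>i. z (i + Suc k) x) + (\<Sum>i<Suc k. z i x)" by (simp add: F_def)
      moreover have "(\<Sum>i<Suc k. z i x) = X (Suc k) x"
        unfolding z_def by (subst sum_lessThan_telescope) (simp add: X0)
      ultimately show "F x - X (Suc k) x = (\<Sum>i. z (i + Suc k) x)" by simp
    qed
    then have "(LINT x|M. \<bar>F x - X (Suc k) x\<bar>) = (LINT x|M. \<bar>\<Sum>i. z (i + Suc k) x\<bar>)"
      by (intro integral_cong_AE borel_measurable_integrable integrable_abs
          integrable_suminf_of_summable_norms(2) sums Bochner_Integration.integrable_diff X F z) auto
    also have "\<dots> \<le> (\<Sum>i. LINT x|M. \<bar>z (i + Suc k) x\<bar>)"
      by (intro integrable_suminf_of_summable_norms(3) sums z)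
    also have "\<dots> \<le> (\<Sum>i. (1/3) ^ i * (1/3) ^ Suc k)"
    proof (rule suminf_le)
      show "(LINT x|M. \<bar>z (i + Suc k) x\<bar>) \<le> (1/3) ^ i * (1/3) ^ Suc k" for i
        using z1[of "i + Suc k"] by (simp only: power_add)
    qed (use sums[of "Suc k"] in \<open>auto intro!: summable_mult2\<close>)
    also have "\<dots> = (\<Sum>i. (1/3) ^ i) * (1/3) ^ Suc k"
      by (rule suminf_mult2[symmetric]) simp
    also have "\<dots> = 1 / (2 * 3 ^ k)"
      by (subst suminf_geometric) (auto simp: power_one_over field_simps)
    finally show ?thesis .
  qed
  have growth: "real k + 1 \<le> \<bar>LINT x|M. g (n k) x * F x\<bar>" for k
  proof -
    have D0: "0 \<le> D k" by (rule order_trans[OF _ D]) simp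
    have "(LINT x|M. g (n k) x * F x)
        = (LINT x|M. g (n k) x * X (Suc k) x) + (LINT x|M. g (n k) x * (F x - X (Suc k) x))"
      using gX[of F k] gX[of "X (Suc k)" k] by (simp add: right_diff_distrib)
    moreover have "\<bar>LINT x|M. g (n k) x * (F x - X (Suc k) x)\<bar> \<le> 3/2 * D k * (1 / (2 * 3 ^ k))"
      by (rule order_trans[OF abs_integral_mult_ess_bounded[OF meas _ g] mult_left_mono[OF tail]])
        (use D0 in auto)
    moreover have "D k / 3 ^ k - 3/2 * D k * (1 / (2 * 3 ^ k)) = D k / (4 * 3 ^ k)"
      by (simp add: field_simps)
    moreover have "real k + 1 \<le> D k / (4 * 3 ^ k)"
      using D[of k] by (simp add: field_simps)
    ultimately show ?thesis using large[of k] by linarith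
  qed
  obtain B where B: "\<bar>LINT x|M. g m x * F x\<bar> \<le> B" for m
    using bdd[OF F] by (auto simp: bounded_iff)
  obtain k where "B < real k" using reals_Archimedean2 by blast
  then show False using growth[of k] B[of "n k"] by linarith
qed

section \<open>Weak* convergence on compact families in \<open>L\<^sup>1\<close>\<close>

text \<open>A one-sided Scheffe lemma: as \<open>\<bar>F\<^sub>n - f\<bar> = 2 max 0 (f - F\<^sub>n) + (F\<^sub>n - f)\<close> and the last
  term has integral zero, only the amount by which \<open>F\<^sub>n\<close> falls short of \<open>f\<close> matters, and that
  is dominated by \<open>f\<close>.\<close>

lemma tendsto_L1_if_lower_limit:
  fixes F :: "nat \<Rightarrow> 'a \<Rightarrow> real"
  assumes F: "\<And>n. integrable M (F n)" and f: "integrable M f"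
    and nonneg: "\<And>n x. 0 \<le> F n x" "\<And>x. 0 \<le> f x"
    and mass: "\<And>n. (LINT x|M. F n x) = (LINT x|M. f x)"
    and lower: "\<And>x. (\<lambda>n. max 0 (f x - F n x)) \<longlonglongrightarrow> 0"
  shows "(\<lambda>n. LINT x|M. \<bar>F n x - f x\<bar>) \<longlonglongrightarrow> 0"
proof -
  have [measurable]: "F n \<in> borel_measurable M" "f \<in> borel_measurable M" for n
    using F f by auto
  have pos: "integrable M (\<lambda>x. max 0 (f x - F n x))" for n
    by (rule Bochner_Integration.integrable_bound[OF f]) (use nonneg in \<open>auto simp: max_def\<close>)
  have "(LINT x|M. \<bar>F n x - f x\<bar>) = 2 * (LINT x|M. max 0 (f x - F n x))" for n
  proof -
    have "\<bar>F n x - f x\<bar> = 2 * max 0 (f x - F n x) + (F n x - f x)" for x by (simp add: max_def)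
    then show ?thesis using pos[of n] F[of n] f mass[of n] by simp
  qed
  moreover have "(\<lambda>n. LINT x|M. max 0 (f x - F n x)) \<longlonglongrightarrow> (LINT x|M. 0)"
    by (rule integral_dominated_convergence[where w = f])
      (use f nonneg lower in \<open>auto simp: max_def\<close>)
  ultimately show ?thesis using tendsto_mult_right_zero by simp
qed

text \<open>Otherwise \<open>\<bar>\<integral> g\<^sub>n h\<^sub>s\<bar> \<ge> \<epsilon>\<close> along some \<open>n = r k\<close>, \<open>s = s\<^sub>k\<close>, where one may assume
  that \<open>s\<^sub>k\<close> converges to some \<open>t\<close>. Replacing \<open>h\<^sub>s\<close> by \<open>h\<^sub>t\<close> costs at most \<open>C\<close> times their
  \<open>L\<^sup>1\<close> distance, and \<open>\<integral> g\<^sub>n h\<^sub>t\<close> tends to zero.\<close>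

lemma uniform_limit_weak_star_on_L1_compact:
  fixes h :: "'t::metric_space \<Rightarrow> 'a \<Rightarrow> real" and g :: "nat \<Rightarrow> 'a \<Rightarrow> real"
  assumes K: "compact K" and h: "\<And>t. t \<in> K \<Longrightarrow> integrable M (h t)"
    and cont: "\<And>s t. (\<And>n. s n \<in> K) \<Longrightarrow> t \<in> K \<Longrightarrow> s \<longlonglongrightarrow> t \<Longrightarrow>
      (\<lambda>n. LINT x|M. \<bar>h (s n) x - h t x\<bar>) \<longlonglongrightarrow> 0"
    and meas: "\<And>n. g n \<in> borel_measurable M" and g: "\<And>n. AE x in M. \<bar>g n x\<bar> \<le> C"
    and lim: "\<And>t. t \<in> K \<Longrightarrow> (\<lambda>n. LINT x|M. g n x * h t x) \<longlonglongrightarrow> 0"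
  shows "uniform_limit K (\<lambda>n t. LINT x|M. g n x * h t x) (\<lambda>_. 0) sequentially"
proof (rule ccontr)
  assume "\<not> ?thesis"
  then obtain \<epsilon> where \<epsilon>: "0 < \<epsilon>"
    and "\<not> (\<forall>\<^sub>F n in sequentially. \<forall>t\<in>K. \<bar>LINT x|M. g n x * h t x\<bar> < \<epsilon>)"
    by (auto simp: uniform_limit_iff)
  then have "\<forall>m. \<exists>n\<ge>m. \<exists>t\<in>K. \<epsilon> \<le> \<bar>LINT x|M. g n x * h t x\<bar>"
    by (force simp: eventually_sequentially not_less)
  then have "\<exists>\<^sub>\<infinity>n. \<exists>t\<in>K. \<epsilon> \<le> \<bar>LINT x|M. g n x * h t x\<bar>"
    by (simp add: INFM_nat_le)
  then have "infinite {n. \<exists>t\<in>K. \<epsilon> \<le> \<bar>LINT x|M. g n x * h t x\<bar>}"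
    by (simp add: frequently_cofinite)
  then obtain r :: "nat \<Rightarrow> nat" where r: "strict_mono r"
    and "\<And>k. \<exists>t\<in>K. \<epsilon> \<le> \<bar>LINT x|M. g (r k) x * h t x\<bar>"
    using infinite_enumerate by blast
  then obtain s where s: "\<And>k. s k \<in> K" and large: "\<And>k. \<epsilon> \<le> \<bar>LINT x|M. g (r k) x * h (s k) x\<bar>"
    by metis
  from K s obtain t l where t: "t \<in> K" and l: "strict_mono (l :: nat \<Rightarrow> nat)" and st: "(s \<circ> l) \<longlonglongrightarrow> t"
    unfolding compact_def by metis
  let ?m = "\<lambda>k. r (l k)"
  have "(\<lambda>k. LINT x|M. g (?m k) x * h t x) \<longlonglongrightarrow> 0"
    using LIMSEQ_subseq_LIMSEQ[OF LIMSEQ_subseq_LIMSEQ[OF lim[OF t] r] l] by (simp add: o_def)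
  moreover have "(\<lambda>k. C * (LINT x|M. \<bar>h (s (l k)) x - h t x\<bar>)) \<longlonglongrightarrow> 0"
    by (rule tendsto_mult_right_zero, rule cont) (use s t st in \<open>auto simp: o_def\<close>)
  ultimately have "(\<lambda>k. \<bar>LINT x|M. g (?m k) x * h t x\<bar> + C * (LINT x|M. \<bar>h (s (l k)) x - h t x\<bar>)) \<longlonglongrightarrow> 0"
    by (auto intro: tendsto_add_zero tendsto_rabs_zero)
  then have "\<forall>\<^sub>F k in sequentially.
      \<bar>LINT x|M. g (?m k) x * h t x\<bar> + C * (LINT x|M. \<bar>h (s (l k)) x - h t x\<bar>) < \<epsilon>"
    using \<epsilon> by (rule order_tendstoD)
  then obtain k where k: "\<bar>LINT x|M. g (?m k) x * h t x\<bar> + C * (LINT x|M. \<bar>h (s (l k)) x - h t x\<bar>) < \<epsilon>"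
    by (auto simp: eventually_sequentially)
  have hs: "integrable M (h (s (l k)))" and ht: "integrable M (h t)" using h s t by auto
  have "(LINT x|M. g (?m k) x * h (s (l k)) x)
      = (LINT x|M. g (?m k) x * h t x) + (LINT x|M. g (?m k) x * (h (s (l k)) x - h t x))"
    using integrable_mult_ess_bounded[OF meas hs g] integrable_mult_ess_bounded[OF meas ht g]
    by (simp add: right_diff_distrib)
  moreover have "\<bar>LINT x|M. g (?m k) x * (h (s (l k)) x - h t x)\<bar> \<le> C * (LINT x|M. \<bar>h (s (l k)) x - h t x\<bar>)"
    by (rule abs_integral_mult_ess_bounded[OF meas _ g]) (use hs ht in auto)
  ultimately show False using k large[of "l k"] by linarith
qed

section \<open>Transport along a flow\<close>

lemma continuous_on_det [continuous_intros]:
  fixes A :: "'a::topological_space \<Rightarrow> 'b::{real_normed_field} ^ 'n ^ 'n"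
  assumes "continuous_on S A"
  shows "continuous_on S (\<lambda>x. det (A x))"
  unfolding det_def by (intro continuous_intros assms)

text \<open>The density \<open>\<bar>det D\<phi>\<^sub>t\<bar> (1\<^sub>U \<circ> \<phi>\<^sub>t)\<close> has mass \<open>\<bar>U\<bar>\<close> for every \<open>t\<close>. As \<open>U\<close> is open, a
  point with \<open>\<phi>\<^sub>t x \<in> U\<close> keeps this property at nearby times, so that no density is lost in the
  limit at \<open>x\<close>; density gained elsewhere is excluded by the constant mass.\<close>

lemma L1_continuous_flow_density:
  fixes \<phi> :: "'t::metric_space \<Rightarrow> real ^ 'n::finite \<Rightarrow> real ^ 'n"
  assumes bij: "\<And>t. t \<in> K \<Longrightarrow> bij (\<phi> t)"
    and diff: "\<And>t x. t \<in> K \<Longrightarrow> \<phi> t differentiable (at x)"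
    and cont: "continuous_on (K \<times> UNIV) (\<lambda>(t, x). \<phi> t x)"
    and contJ: "continuous_on (K \<times> UNIV) (\<lambda>(t, x). jacobian (\<phi> t) (at x))"
    and U: "open U" "U \<in> lmeasurable"
    and s: "\<And>n. s n \<in> K" and t: "t \<in> K" and st: "s \<longlonglongrightarrow> t"
  shows "(\<lambda>n. LINT x|lebesgue. \<bar>\<bar>det (jacobian (\<phi> (s n)) (at x))\<bar> * indicator U (\<phi> (s n) x)
      - \<bar>det (jacobian (\<phi> t) (at x))\<bar> * indicator U (\<phi> t x)\<bar>) \<longlonglongrightarrow> 0"
proof -
  have ind: "integrable lebesgue (indicator U :: _ \<Rightarrow> real)"
    using U by (simp add: fmeasurable_def)
  note cov = jacobian_change_of_variables[OF bij diff ind]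
  show ?thesis
  proof (rule tendsto_L1_if_lower_limit)
    fix x :: "real ^ 'n"
    have pt: "(\<lambda>n. (s n, x)) \<longlonglongrightarrow> (t, x)" by (intro tendsto_Pair st tendsto_const)
    have lim\<phi>: "(\<lambda>n. \<phi> (s n) x) \<longlonglongrightarrow> \<phi> t x"
      using continuous_on_tendsto_compose[OF cont pt] s t by simp
    have limJ: "(\<lambda>n. \<bar>det (jacobian (\<phi> (s n)) (at x))\<bar>) \<longlonglongrightarrow> \<bar>det (jacobian (\<phi> t) (at x))\<bar>"
      using continuous_on_tendsto_compose[OF continuous_on_rabs[OF continuous_on_det[OF contJ]] pt] s t
      by simp
    show "(\<lambda>n. max 0 (\<bar>det (jacobian (\<phi> t) (at x))\<bar> * indicator U (\<phi> t x)
        - \<bar>det (jacobian (\<phi> (s n)) (at x))\<bar> * indicator U (\<phi> (s n) x))) \<longlonglongrightarrow> (0::real)"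
    proof (cases "\<phi> t x \<in> U")
      case True
      then have "\<forall>\<^sub>F n in sequentially. \<phi> (s n) x \<in> U"
        using lim\<phi> U(1) by (rule topological_tendstoD[rotated 2])
      then have "\<forall>\<^sub>F n in sequentially. max 0 (\<bar>det (jacobian (\<phi> t) (at x))\<bar> - \<bar>det (jacobian (\<phi> (s n)) (at x))\<bar>)
          = max 0 (\<bar>det (jacobian (\<phi> t) (at x))\<bar> * indicator U (\<phi> t x)
            - \<bar>det (jacobian (\<phi> (s n)) (at x))\<bar> * indicator U (\<phi> (s n) x))"
        by (rule eventually_mono) (simp add: True)
      moreover have "(\<lambda>n. max 0 (\<bar>det (jacobian (\<phi> t) (at x))\<bar> - \<bar>det (jacobian (\<phi> (s n)) (at x))\<bar>)) \<longlonglongrightarrow>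
          max 0 (\<bar>det (jacobian (\<phi> t) (at x))\<bar> - \<bar>det (jacobian (\<phi> t) (at x))\<bar>)"
        by (intro tendsto_max tendsto_diff tendsto_const limJ)
      ultimately show ?thesis by (simp add: Lim_transform_eventually)
    next
      case False
      then show ?thesis by (simp add: max_absorb1)
    qed
  qed (use cov s t in auto)
qed

text \<open>For the indicator of an open set, changing variables moves the time dependence from \<open>g\<^sub>n\<close> to
  the density of the previous lemma. By outer regularity and density of simple functions, such
  indicators span a dense subspace of \<open>L\<^sup>1\<close>, and the bound \<open>C\<close>, which \<open>g\<^sub>n \<circ> \<phi>\<^sub>t\<inverse>\<close> inherits,
  makes the set of good \<open>f\<close> closed.\<close>

theorem uniform_limit_weak_star_transport:
  fixes \<phi> :: "'t::metric_space \<Rightarrow> real ^ 'n::finite \<Rightarrow> real ^ 'n" and g :: "nat \<Rightarrow> real ^ 'n \<Rightarrow> real"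
  assumes K: "compact K"
    and bij: "\<And>t. t \<in> K \<Longrightarrow> bij (\<phi> t)"
    and diff: "\<And>t x. t \<in> K \<Longrightarrow> \<phi> t differentiable (at x)"
    and cont: "continuous_on (K \<times> UNIV) (\<lambda>(t, x). \<phi> t x)"
    and contJ: "continuous_on (K \<times> UNIV) (\<lambda>(t, x). jacobian (\<phi> t) (at x))"
    and meas: "\<And>n. g n \<in> borel_measurable lebesgue"
    and g: "\<And>n. AE x in lebesgue. \<bar>g n x\<bar> \<le> C"
    and lim: "\<And>f. integrable lebesgue f \<Longrightarrow> (\<lambda>n. LINT x|lebesgue. g n x * f x) \<longlonglongrightarrow> 0"
    and f: "integrable lebesgue f"
  shows "uniform_limit K (\<lambda>n t. LINT y|lebesgue. g n (inv (\<phi> t) y) * f y) (\<lambda>_. 0) sequentially"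
proof -
  define P where "P = (\<lambda>f. uniform_limit K (\<lambda>n t. LINT y|lebesgue. g n (inv (\<phi> t) y) * f y) (\<lambda>_. 0) sequentially)"
  have meas': "(\<lambda>y. g n (inv (\<phi> t) y)) \<in> borel_measurable lebesgue"
    and g': "AE y in lebesgue. \<bar>g n (inv (\<phi> t) y)\<bar> \<le> C" if "t \<in> K" for n t
    using borel_measurable_lebesgue_inv_diffeo[OF bij diff meas] ess_bounded_inv_diffeo[OF bij diff meas g] that
    by auto
  note int' = integrable_mult_ess_bounded[OF meas' _ g']
  note bound' = abs_integral_mult_ess_bounded[OF meas' _ g']
  have open_case: "P (indicator U)" if U: "open U" "U \<in> lmeasurable" for U
  proof -
    have ind: "integrable lebesgue (indicator U :: _ \<Rightarrow> real)"
      using U by (auto simp: fmeasurable_def intro!: integrable_real_indicator)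
    let ?h = "\<lambda>t x. \<bar>det (jacobian (\<phi> t) (at x))\<bar> * indicator U (\<phi> t x) :: real"
    have h: "integrable lebesgue (?h t)" if "t \<in> K" for t
      using jacobian_change_of_variables(1)[OF bij diff ind] that by simp
    have "uniform_limit K (\<lambda>n t. LINT x|lebesgue. g n x * ?h t x) (\<lambda>_. 0) sequentially"
      by (rule uniform_limit_weak_star_on_L1_compact[OF K h _ meas g])
        (use L1_continuous_flow_density[OF bij diff cont contJ U] lim h in auto)
    moreover have "(LINT x|lebesgue. g n x * ?h t x)
        = (LINT y|lebesgue. g n (inv (\<phi> t) y) * indicator U y)" if "t \<in> K" for n t
      using jacobian_change_of_variables(2)[OF bij diff int'[OF that ind that, of n], of t] bij[OF that] that
      by (simp add: bij_is_inj mult_ac)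
    ultimately show ?thesis
      unfolding P_def by (simp cong: uniform_limit_cong')
  qed
  have approx: "P f" if f: "integrable lebesgue f"
    and ex: "\<And>\<epsilon>. 0 < \<epsilon> \<Longrightarrow> \<exists>f'. integrable lebesgue f' \<and> P f' \<and> (LINT y|lebesgue. \<bar>f y - f' y\<bar>) \<le> \<epsilon>" for f
    unfolding P_def
  proof (rule uniform_limitI)
    fix \<epsilon> :: real assume "0 < \<epsilon>"
    define \<delta> where "\<delta> = \<epsilon> / (2 * (\<bar>C\<bar> + 1))"
    have "0 < \<delta>" using \<open>0 < \<epsilon>\<close> by (simp add: \<delta>_def add_nonneg_pos)
    then obtain f' where f': "integrable lebesgue f'" "P f'" and ff': "(LINT y|lebesgue. \<bar>f y - f' y\<bar>) \<le> \<delta>"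
      using ex by blast
    have "C * (LINT y|lebesgue. \<bar>f y - f' y\<bar>) \<le> (\<bar>C\<bar> + 1) * \<delta>"
      by (rule mult_mono) (use ff' in auto)
    also have "\<dots> = \<epsilon> / 2"
      using \<open>0 < \<epsilon>\<close> by (simp add: \<delta>_def add_nonneg_pos[THEN less_imp_neq[THEN not_sym]] field_simps)
    finally have small: "C * (LINT y|lebesgue. \<bar>f y - f' y\<bar>) \<le> \<epsilon> / 2" .
    have "\<forall>\<^sub>F n in sequentially. \<forall>t\<in>K. \<bar>LINT y|lebesgue. g n (inv (\<phi> t) y) * f' y\<bar> < \<epsilon> / 2"
      using uniform_limitD[OF f'(2)[unfolded P_def], of "\<epsilon> / 2"] \<open>0 < \<epsilon>\<close> by simp
    then show "\<forall>\<^sub>F n in sequentially. \<forall>t\<in>K. dist (LINT y|lebesgue. g n (inv (\<phi> t) y) * f y) 0 < \<epsilon>"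
    proof (rule eventually_mono, intro ballI)
      fix n t assume n: "\<forall>t\<in>K. \<bar>LINT y|lebesgue. g n (inv (\<phi> t) y) * f' y\<bar> < \<epsilon> / 2" and t: "t \<in> K"
      have "(LINT y|lebesgue. g n (inv (\<phi> t) y) * f y) = (LINT y|lebesgue. g n (inv (\<phi> t) y) * f' y)
          + (LINT y|lebesgue. g n (inv (\<phi> t) y) * (f y - f' y))"
        using int'[OF t f t, of n] int'[OF t f'(1) t, of n] by (simp add: right_diff_distrib)
      moreover have "\<bar>LINT y|lebesgue. g n (inv (\<phi> t) y) * (f y - f' y)\<bar> \<le> C * (LINT y|lebesgue. \<bar>f y - f' y\<bar>)"
        by (rule bound'[OF t _ t]) (use f f' in auto)
      ultimately show "dist (LINT y|lebesgue. g n (inv (\<phi> t) y) * f y) 0 < \<epsilon>"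
        using bspec[OF n t] small by (simp add: dist_real_def)
    qed
  qed
  have "P f"
    using f
  proof (induction rule: integrable_induct)
    case (base A c)
    have A: "A \<in> lmeasurable" using base by (simp add: fmeasurable_def)
    then have iA: "integrable lebesgue (\<lambda>y. indicator A y *\<^sub>R c)"
      by (auto simp: fmeasurable_def intro!: integrable_scaleR_left integrable_real_indicator)
    show ?case
    proof (rule approx[OF iA])
      fix \<epsilon> :: real assume \<epsilon>: "0 < \<epsilon>"
      define \<delta> where "\<delta> = \<epsilon> / (\<bar>c\<bar> + 1)"
      have "0 < \<delta>" using \<epsilon> by (simp add: \<delta>_def add_nonneg_pos)
      then obtain U where U: "open U" "A \<subseteq> U" "U - A \<in> lmeasurable" "emeasure lebesgue (U - A) < ennreal \<delta>"
        using sets_lebesgue_outer_open[OF base(1)] by metis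
      have Um: "U \<in> lmeasurable"
        using fmeasurable.Un[OF A U(3)] U(2) by (simp add: Un_absorb1)
      have "measure lebesgue (U - A) \<le> \<delta>"
        using U(4) \<open>0 < \<delta>\<close> by (simp add: measure_def enn2real_leI)
      have "(LINT y|lebesgue. \<bar>indicator A y *\<^sub>R c - indicator U y * c\<bar>) = (LINT y|lebesgue. \<bar>c\<bar> * indicator (U - A) y)"
        using U(2) by (intro Bochner_Integration.integral_cong) (auto simp: indicator_def)
      also have "\<dots> = \<bar>c\<bar> * measure lebesgue (U - A)"
        using U(3) by simp
      also have "\<dots> \<le> (\<bar>c\<bar> + 1) * \<delta>"
        by (rule mult_mono) (use \<open>measure lebesgue (U - A) \<le> \<delta>\<close> in auto)
      also have "\<dots> = \<epsilon>" by (simp add: \<delta>_def add_nonneg_pos[THEN less_imp_neq[THEN not_sym]])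
      finally have "(LINT y|lebesgue. \<bar>indicator A y *\<^sub>R c - indicator U y * c\<bar>) \<le> \<epsilon>" .
      moreover have "P (\<lambda>y. indicator U y * c)"
        using bounded_linear.uniform_limit[OF bounded_linear_mult_left open_case[OF U(1) Um, unfolded P_def], of c]
        by (simp add: P_def mult.assoc[symmetric])
      moreover have "integrable lebesgue (\<lambda>y. indicator U y * c)"
        using Um by (auto simp: fmeasurable_def intro!: integrable_mult_left integrable_real_indicator)
      ultimately show "\<exists>f'. integrable lebesgue f' \<and> P f' \<and> (LINT y|lebesgue. \<bar>indicator A y *\<^sub>R c - f' y\<bar>) \<le> \<epsilon>"
        by blast
    qed
  next
    case (add f1 f2)
    have "uniform_limit K (\<lambda>n t. (LINT y|lebesgue. g n (inv (\<phi> t) y) * f1 y) + (LINT y|lebesgue. g n (inv (\<phi> t) y) * f2 y))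
        (\<lambda>_. 0 + 0) sequentially"
      using add(3,4) unfolding P_def by (rule uniform_limit_add)
    moreover have "(LINT y|lebesgue. g n (inv (\<phi> t) y) * (f1 y + f2 y))
        = (LINT y|lebesgue. g n (inv (\<phi> t) y) * f1 y) + (LINT y|lebesgue. g n (inv (\<phi> t) y) * f2 y)" if "t \<in> K" for n t
      using int'[OF that add(1) that, of n] int'[OF that add(2) that, of n] by (simp add: distrib_left)
    ultimately show ?case
      unfolding P_def by (simp cong: uniform_limit_cong')
  next
    case (lim f s)
    have "(\<lambda>i. LINT y|lebesgue. \<bar>f y - s i y\<bar>) \<longlonglongrightarrow> (LINT y|(lebesgue :: (real ^ 'n) measure). 0)"
    proof (rule integral_dominated_convergence[where w = "\<lambda>y. 3 * \<bar>f y\<bar>"])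
      show "AE y in lebesgue. (\<lambda>i. \<bar>f y - s i y\<bar>) \<longlonglongrightarrow> 0"
      proof (rule AE_I2)
        fix y
        have "(\<lambda>i. \<bar>f y - s i y\<bar>) \<longlonglongrightarrow> \<bar>f y - f y\<bar>"
          by (intro tendsto_rabs tendsto_diff tendsto_const) (use lim(2)[of y] in simp)
        then show "(\<lambda>i. \<bar>f y - s i y\<bar>) \<longlonglongrightarrow> 0" by simp
      qed
      show "AE y in lebesgue. norm \<bar>f y - s i y\<bar> \<le> 3 * \<bar>f y\<bar>" for i
      proof (rule AE_I2)
        fix y
        have "\<bar>s i y\<bar> \<le> 2 * \<bar>f y\<bar>" using lim(3)[of y i] by simp
        then show "norm \<bar>f y - s i y\<bar> \<le> 3 * \<bar>f y\<bar>" by simp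
      qed
    qed (use lim(1,4) in auto)
    then have lim0: "(\<lambda>i. LINT y|lebesgue. \<bar>f y - s i y\<bar>) \<longlonglongrightarrow> 0" by simp
    show ?case
    proof (rule approx[OF lim(4)])
      fix \<epsilon> :: real assume "0 < \<epsilon>"
      with lim0 obtain i where "(LINT y|lebesgue. \<bar>f y - s i y\<bar>) < \<epsilon>"
        by (metis (mono_tags, lifting) eventually_happens order_tendstoD(2) sequentially_bot)
      then show "\<exists>f'. integrable lebesgue f' \<and> P f' \<and> (LINT y|lebesgue. \<bar>f y - f' y\<bar>) \<le> \<epsilon>"
        using lim(1,5) less_imp_le by blast
    qed
  qed
  then show ?thesis by (simp add: P_def)
qed

section \<open>The weak* convergence along the stochastic flow\<close>

lemma
  assumes vs: "\<And>n. vs n \<in> Linf" and v: "v \<in> Linf" and lim: "weak_star_convergent vs v"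
  shows weak_star_convergent_diff_null:
      "integrable lebesgue f \<Longrightarrow> (\<lambda>n. LINT x|lebesgue. (vs n x - v x) * f x) \<longlonglongrightarrow> 0"
    and weak_star_convergent_ess_bounded:
      "\<exists>C. \<forall>n. AE x in lebesgue. \<bar>vs n x - v x\<bar> \<le> C"
proof -
  have [measurable]: "vs n \<in> borel_measurable lebesgue" "v \<in> borel_measurable lebesgue" for n
    using vs[of n] v by (auto simp: Linf_def)
  obtain B where B: "AE x in lebesgue. \<bar>v x\<bar> \<le> B" using v by (auto simp: Linf_def)
  have bdd: "\<exists>C. AE x in lebesgue. \<bar>vs n x - v x\<bar> \<le> C" for n
  proof -
    obtain A where "AE x in lebesgue. \<bar>vs n x\<bar> \<le> A" using vs[of n] by (auto simp: Linf_def)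
    with B have "AE x in lebesgue. \<bar>vs n x - v x\<bar> \<le> A + B" by eventually_elim linarith
    then show ?thesis by blast
  qed
  have null: "(\<lambda>n. LINT x|lebesgue. (vs n x - v x) * f x) \<longlonglongrightarrow> 0" if f: "integrable lebesgue f" for f
  proof -
    have "integrable lebesgue (\<lambda>x. vs n x * f x)" for n
      using vs[of n] integrable_mult_ess_bounded[OF _ f] by (auto simp: Linf_def)
    moreover have "integrable lebesgue (\<lambda>x. v x * f x)"
      using integrable_mult_ess_bounded[OF _ f B] by simp
    moreover have "(\<lambda>n. LINT x|lebesgue. vs n x * f x) \<longlonglongrightarrow> (LINT x|lebesgue. v x * f x)"
      using lim f by (simp add: weak_star_convergent_def)
    ultimately show ?thesis by (simp add: left_diff_distrib LIM_zero_iff)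
  qed
  show "(\<lambda>n. LINT x|lebesgue. (vs n x - v x) * f x) \<longlonglongrightarrow> 0" if "integrable lebesgue f"
    using that by (rule null)
  have diff: "(\<lambda>x. vs n x - v x) \<in> borel_measurable lebesgue" for n by measurable
  have range: "bounded (range (\<lambda>n. LINT x|lebesgue. (vs n x - v x) * f x))" if "integrable lebesgue f" for f
    using null[OF that] by (auto intro: convergent_imp_bounded)
  show "\<exists>C. \<forall>n. AE x in lebesgue. \<bar>vs n x - v x\<bar> \<le> C"
    by (rule sigma_finite_measure.ess_bounded_if_pointwise_bounded[OF sigma_finite_lebesgue diff bdd range])
qed

theorem proposition12:
  fixes M :: "'w measure" and F :: "real \<Rightarrow> 'w measure"
    and W :: "real \<Rightarrow> 'w \<Rightarrow> real ^ 'n"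
    and T \<sigma> \<alpha> :: real
    and b :: "real \<Rightarrow> real ^ 'n \<Rightarrow> real ^ 'n"
    and \<phi> :: "real \<Rightarrow> 'w \<Rightarrow> real ^ 'n \<Rightarrow> real ^ 'n"
    and vs :: "nat \<Rightarrow> real ^ 'n \<Rightarrow> real" and v :: "real ^ 'n \<Rightarrow> real"
  assumes "brownian_motion M F W"
    and "T > 0" and "\<sigma> \<noteq> 0"
    and "\<alpha> \<in> {0<..<1}" and "b \<in> Linf_Holder T \<alpha>"
    and "stochastic_flow M F W T b \<sigma> \<phi>"
    and "\<And>n. vs n \<in> Linf" and "v \<in> Linf"
    and "weak_star_convergent vs v"
  shows "AE \<omega> in M. \<forall>f. integrable lebesgue f \<longrightarrow>
    (\<lambda>n. SUP t\<in>{0..T}.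
       ereal \<bar>LINT y|lebesgue. (vs n (inv (\<phi> t \<omega>) y) - v (inv (\<phi> t \<omega>) y)) * f y\<bar>)
    \<longlonglongrightarrow> 0"
proof -
  define g where "g = (\<lambda>n x. vs n x - v x)"
  have meas: "g n \<in> borel_measurable lebesgue" for n
    using assms(7)[of n] assms(8) by (auto simp: g_def Linf_def)
  obtain C where C: "AE x in lebesgue. \<bar>g n x\<bar> \<le> C" for n
    using weak_star_convergent_ess_bounded[OF assms(7-9)] unfolding g_def by blast
  have lim: "(\<lambda>n. LINT x|lebesgue. g n x * f x) \<longlonglongrightarrow> 0" if "integrable lebesgue f" for f
    using weak_star_convergent_diff_null[OF assms(7-9) that] by (simp add: g_def)
  from assms(6)[unfolded stochastic_flow_def, THEN conjunct2] show ?thesis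
  proof eventually_elim
    case (elim \<omega>)
    show ?case
    proof (intro allI impI)
      fix f :: "real ^ 'n \<Rightarrow> real" assume f: "integrable lebesgue f"
      have unif: "uniform_limit {0..T} (\<lambda>n t. LINT y|lebesgue. g n (inv (\<phi> t \<omega>) y) * f y) (\<lambda>_. 0) sequentially"
        by (rule uniform_limit_weak_star_transport[OF _ _ _ _ _ meas C lim f])
          (use elim in \<open>auto simp: diffeomorphism_def\<close>)
      let ?I = "\<lambda>n t. \<bar>LINT y|lebesgue. g n (inv (\<phi> t \<omega>) y) * f y\<bar>"
      have "(\<lambda>n. SUP t\<in>{0..T}. ereal (?I n t)) \<longlonglongrightarrow> 0"
      proof (rule order_tendstoI)
        fix a :: ereal assume "a < 0"
        moreover have "0 \<le> (SUP t\<in>{0..T}. ereal (?I n t))" for n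
          by (rule SUP_upper2[of 0]) (use \<open>T > 0\<close> in auto)
        ultimately show "\<forall>\<^sub>F n in sequentially. a < (SUP t\<in>{0..T}. ereal (?I n t))"
          by (simp add: less_le_trans)
      next
        fix a :: ereal assume "0 < a"
        then obtain \<epsilon> where \<epsilon>: "0 < \<epsilon>" "ereal \<epsilon> < a"
          using ereal_dense2 by (metis ereal_less(2))
        show "\<forall>\<^sub>F n in sequentially. (SUP t\<in>{0..T}. ereal (?I n t)) < a"
          using uniform_limitD[OF unif \<epsilon>(1)]
        proof eventually_elim
          case (elim n)
          then have "(SUP t\<in>{0..T}. ereal (?I n t)) \<le> ereal \<epsilon>"
            by (intro SUP_least) (auto simp: less_imp_le)
          then show ?case using \<epsilon>(2) by (rule le_less_trans)
        qed
      qed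
      then show "(\<lambda>n. SUP t\<in>{0..T}.
          ereal \<bar>LINT y|lebesgue. (vs n (inv (\<phi> t \<omega>) y) - v (inv (\<phi> t \<omega>) y)) * f y\<bar>) \<longlonglongrightarrow> 0"
        by (simp add: g_def)
    qed
  qed
qed

end
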